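(* Let $d^*$ be the optimal value of the peak estimation program $$d^*=\inf_{v,\gamma}\ \gamma\quad\text{subject to}\quad \gamma\ge v(0,x)\ \ \forall x\in X_0;\qquad \mathcal{L}_f v(t,x,w)\le 0\ \ \forall (t,x,w)\in[0,T]\times X\times W;\qquad v(t,x)\ge p(x)\ \ \forall (t,x)\in[0,T]\times X,$$ over $\gamma\in\mathbb{R}$ and $v\in C^1([0,T]\times X)$. Then for every $\epsilon>0$ there exists a polynomial $V\in\mathbb{R}[t,x]$ such that $(v,\gamma)=(V,\ d^*+\tfrac52\epsilon)$ is feasible for this program and the Lie derivative constraint holds strictly: $$\mathcal{L}_f V(t,x,w)<0\qquad\forall (t,x,w)\in[0,T]\times X\times W.$$
   Context: Standing setting. $T>0$ is finite. $X\subset\mathbb{R}^n$ and $X_0\subset X$ are compact. The dynamics are $\dot x=f(t,x,w)=f_0(t,x)+\sum_{\ell=1}^L w_\ell f_\ell(t,x)$ with $f_0,\dots,f_L$ valued in $\mathbb{R}^n$ and Lipschitz on $[0,T]\times X$. The input set $W\subset\mathbb{R}^L$ is a compact set with nonempty interior that is semidefinite representable (SDR), i.e. $W=\{w:\exists\lambda_s\in\mathbb{R}^{q_s},\ A_sw+G_s\lambda_s+e_s\in K_s,\ s=1,\dots,N_s\}$, where each $K_s$ is a convex pointed cone with nonempty interior (a subset of a vectorized positive semidefinite cone); if the cones are non-polyhedral there is a Slater point $(\bar w,\bar\lambda)$ with $A_s\bar w+G_s\bar\lambda_s+e_s\in\mathrm{int}(K_s)$ for all $s$. Non-return assumption: writing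 $x(t\mid x_0,w(\cdot))$ for the trajectory started at $x_0\in X_0$ under a $W$-valued input $w(\cdot)$ (not necessarily continuous), if $x(t\mid x_0,w(\cdot))\in\partial X$ for some $t\in[0,T]$, then $x(t'\mid x_0,\hat w(\cdot))\notin X$ for all $t'\in(t,T]$ and every $W$-valued input $\hat w(\cdot)$ on $[0,T]$ that agrees with $w(\cdot)$ on $[0,t]$. The objective $p$ is lower semicontinuous and bounded on $X$. The Lie derivative is $\mathcal{L}_f v(t,x,w)=\partial_t v(t,x)+\nabla_x v(t,x)\cdot f_0(t,x)+\sum_{\ell=1}^L w_\ell\,\nabla_x v(t,x)\cdot f_\ell(t,x)$. $C^1([0,T]\times X)$ denotes functions with continuous first derivatives (understood as restrictions of $C^1$ functions defined on a neighbourhood of $[0,T]\times X$). *)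

theory Defs
  imports "HOL-Analysis.Analysis"
begin

text \<open>
  The numbers of slack variables and the dimensions of the cones vary with the index \<open>s\<close>, so these
  spaces are the spaces \<^const>\<open>Euclidean_space\<close> of the library, whose points are the sequences
  that vanish from index \<open>m\<close> on.
\<close>

abbreviation Rdim :: "nat \<Rightarrow> (nat \<Rightarrow> real) set" where
  "Rdim m \<equiv> topspace (Euclidean_space m)"

definition convex_cone_in :: "nat \<Rightarrow> (nat \<Rightarrow> real) set \<Rightarrow> bool" where
  "convex_cone_in m K \<longleftrightarrow> K \<subseteq> Rdim m \<and>
     (\<forall>y\<in>K. \<forall>z\<in>K. (\<lambda>i. y i + z i) \<in> K) \<and>
     (\<forall>y\<in>K. \<forall>c\<ge>0. (\<lambda>i. c * y i) \<in> K)"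

definition pointed_cone :: "(nat \<Rightarrow> real) set \<Rightarrow> bool" where
  "pointed_cone K \<longleftrightarrow> (\<forall>y. y \<in> K \<and> (\<lambda>i. - y i) \<in> K \<longrightarrow> y = (\<lambda>i. 0))"

definition polyhedral_cone_in :: "nat \<Rightarrow> (nat \<Rightarrow> real) set \<Rightarrow> bool" where
  "polyhedral_cone_in m K \<longleftrightarrow>
     (\<exists>H. finite H \<and> K = {y \<in> Rdim m. \<forall>a\<in>H. (\<Sum>i<m. a i * y i) \<ge> 0})"

definition psd_matrix :: "nat \<Rightarrow> (nat \<Rightarrow> nat \<Rightarrow> real) \<Rightarrow> bool" where
  "psd_matrix k M \<longleftrightarrow> (\<forall>a<k. \<forall>b<k. M a b = M b a) \<and>
     (\<forall>z. (\<Sum>a<k. \<Sum>b<k. z a * M a b * z b) \<ge> 0)"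

text \<open>
  \<open>K\<close> consists of coordinate vectors of positive semidefinite matrices: \<open>y\<close> stands for the symmetric
  matrix with coordinates \<open>y\<close> in the linearly independent family \<open>B\<close>. The usual vectorization of all
  symmetric matrices is the case where \<open>B\<close> is a basis; smaller families also give the usual
  embeddings of orthants (diagonal matrices) and second-order cones.
\<close>

definition in_vectorized_psd_cone :: "nat \<Rightarrow> (nat \<Rightarrow> real) set \<Rightarrow> bool" where
  "in_vectorized_psd_cone m K \<longleftrightarrow>
     (\<exists>k B. (\<forall>i<m. \<forall>a<k. \<forall>b<k. B i a b = B i b a) \<and>
        (\<forall>y \<in> Rdim m. (\<forall>a<k. \<forall>b<k. (\<Sum>i<m. y i * B i a b) = 0) \<longrightarrow> y = (\<lambda>i. 0)) \<and>
        (\<forall>y\<in>K. psd_matrix k (\<lambda>a b. \<Sum>i<m. y i * B i a b)))"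

text \<open>The vector \<open>A w + G \<lambda> + e\<close> of length \<open>m\<close>, for \<open>\<lambda>\<close> of length \<open>q\<close>.\<close>

definition affine_form ::
  "nat \<Rightarrow> nat \<Rightarrow> (nat \<Rightarrow> 'l \<Rightarrow> real) \<Rightarrow> (nat \<Rightarrow> nat \<Rightarrow> real) \<Rightarrow> (nat \<Rightarrow> real)
     \<Rightarrow> real^'l::finite \<Rightarrow> (nat \<Rightarrow> real) \<Rightarrow> nat \<Rightarrow> real" where
  "affine_form m q A G e w y =
     (\<lambda>i. if i < m then (\<Sum>l\<in>UNIV. A i l * w $ l) + (\<Sum>j<q. G i j * y j) + e i else 0)"

definition semidefinite_representable :: "(real^'l::finite) set \<Rightarrow> bool" where
  "semidefinite_representable W \<longleftrightarrow>
     (\<exists>(N::nat) m q A G e K.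
        (\<forall>s<N. convex_cone_in (m s) (K s) \<and> pointed_cone (K s) \<and>
               Euclidean_space (m s) interior_of (K s) \<noteq> {} \<and>
               in_vectorized_psd_cone (m s) (K s)) \<and>
        W = {w. \<exists>y. \<forall>s<N. y s \<in> Rdim (q s) \<and>
                 affine_form (m s) (q s) (A s) (G s) (e s) w (y s) \<in> K s} \<and>
        ((\<exists>s<N. \<not> polyhedral_cone_in (m s) (K s)) \<longrightarrow>
           (\<exists>w y. \<forall>s<N. y s \<in> Rdim (q s) \<and>
              affine_form (m s) (q s) (A s) (G s) (e s) w (y s)
                \<in> Euclidean_space (m s) interior_of (K s))))"

definition dynamics ::
  "(real \<Rightarrow> real^'n \<Rightarrow> real^'n) \<Rightarrow> ('l \<Rightarrow> real \<Rightarrow> real^'n \<Rightarrow> real^'n)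
     \<Rightarrow> real \<Rightarrow> real^'n::finite \<Rightarrow> real^'l::finite \<Rightarrow> real^'n" where
  "dynamics f0 f t x w = f0 t x + (\<Sum>l\<in>UNIV. w $ l *\<^sub>R f l t x)"

definition admissible_input :: "real \<Rightarrow> (real^'l::finite) set \<Rightarrow> (real \<Rightarrow> real^'l) \<Rightarrow> bool" where
  "admissible_input T W w \<longleftrightarrow>
     w \<in> borel_measurable (lebesgue_on {0..T}) \<and> (\<forall>t\<in>{0..T}. w t \<in> W)"

text \<open>
  Inputs need not be continuous, so trajectories are Caratheodory solutions: absolutely continuous
  functions that satisfy the differential equation almost everywhere, in the integral form.
\<close>

definition trajectory ::
  "(real \<Rightarrow> real^'n \<Rightarrow> real^'n) \<Rightarrow> ('l \<Rightarrow> real \<Rightarrow> real^'n \<Rightarrow> real^'n) \<Rightarrow> real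
     \<Rightarrow> real^'n::finite \<Rightarrow> (real \<Rightarrow> real^'l::finite) \<Rightarrow> (real \<Rightarrow> real^'n) \<Rightarrow> bool" where
  "trajectory f0 f \<tau> x0 w x \<longleftrightarrow>
     (\<lambda>s. dynamics f0 f s (x s) (w s)) absolutely_integrable_on {0..\<tau>} \<and>
     (\<forall>t\<in>{0..\<tau>}. x t = x0 + integral {0..t} (\<lambda>s. dynamics f0 f s (x s) (w s)))"

text \<open>
  Trajectories are only required to exist up to the times at which they are evaluated. The vector
  field is Lipschitz only on \<open>X\<close>, so a trajectory need not be determined by its input;
  \<open>x'\<close> is therefore required to continue \<open>x\<close>.
\<close>

definition non_return ::
  "real \<Rightarrow> (real^'n::finite) set \<Rightarrow> (real^'n) set \<Rightarrow> (real^'l::finite) set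
     \<Rightarrow> (real \<Rightarrow> real^'n \<Rightarrow> real^'n) \<Rightarrow> ('l \<Rightarrow> real \<Rightarrow> real^'n \<Rightarrow> real^'n) \<Rightarrow> bool" where
  "non_return T X X0 W f0 f \<longleftrightarrow>
     (\<forall>x0\<in>X0. \<forall>w x t. \<forall>w' x' t'.
        admissible_input T W w \<and> t \<in> {0..T} \<and> trajectory f0 f t x0 w x \<and> x t \<in> frontier X \<and>
        admissible_input T W w' \<and> (\<forall>s\<in>{0..t}. w' s = w s) \<and> t' \<in> {t<..T} \<and>
        trajectory f0 f t' x0 w' x' \<and> (\<forall>s\<in>{0..t}. x' s = x s)
        \<longrightarrow> x' t' \<notin> X)"

definition lower_semicontinuous_on :: "'a::topological_space set \<Rightarrow> ('a \<Rightarrow> real) \<Rightarrow> bool" where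
  "lower_semicontinuous_on S p \<longleftrightarrow> (\<forall>x\<in>S. \<forall>c<p x. \<forall>\<^sub>F y in at x within S. c < p y)"

definition C1_near :: "'a::real_normed_vector set \<Rightarrow> ('a \<Rightarrow> real) \<Rightarrow> bool" where
  "C1_near S v \<longleftrightarrow>
     (\<exists>U v'. open U \<and> S \<subseteq> U \<and> (\<forall>z\<in>U. (v has_derivative blinfun_apply (v' z)) (at z)) \<and>
             continuous_on U v')"

definition grad_x :: "(real \<times> (real^'n) \<Rightarrow> real) \<Rightarrow> real \<Rightarrow> real^'n::finite \<Rightarrow> real^'n" where
  "grad_x v t x = (\<chi> i. frechet_derivative (\<lambda>y. v (t, y)) (at x) (axis i 1))"

definition lie_derivative ::
  "(real \<Rightarrow> real^'n \<Rightarrow> real^'n) \<Rightarrow> ('l \<Rightarrow> real \<Rightarrow> real^'n \<Rightarrow> real^'n)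
     \<Rightarrow> (real \<times> (real^'n) \<Rightarrow> real) \<Rightarrow> real \<Rightarrow> real^'n::finite \<Rightarrow> real^'l::finite \<Rightarrow> real" where
  "lie_derivative f0 f v t x w =
     deriv (\<lambda>s. v (s, x)) t + grad_x v t x \<bullet> f0 t x +
     (\<Sum>l\<in>UNIV. w $ l * (grad_x v t x \<bullet> f l t x))"

definition peak_feasible ::
  "real \<Rightarrow> (real^'n::finite) set \<Rightarrow> (real^'n) set \<Rightarrow> (real^'l::finite) set
     \<Rightarrow> (real \<Rightarrow> real^'n \<Rightarrow> real^'n) \<Rightarrow> ('l \<Rightarrow> real \<Rightarrow> real^'n \<Rightarrow> real^'n)
     \<Rightarrow> (real^'n \<Rightarrow> real) \<Rightarrow> (real \<times> (real^'n) \<Rightarrow> real) \<Rightarrow> real \<Rightarrow> bool" where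
  "peak_feasible T X X0 W f0 f p v \<gamma> \<longleftrightarrow>
     C1_near ({0..T} \<times> X) v \<and>
     (\<forall>x\<in>X0. \<gamma> \<ge> v (0, x)) \<and>
     (\<forall>t\<in>{0..T}. \<forall>x\<in>X. \<forall>w\<in>W. lie_derivative f0 f v t x w \<le> 0) \<and>
     (\<forall>t\<in>{0..T}. \<forall>x\<in>X. v (t, x) \<ge> p x)"

text \<open>
  When \<open>p\<close> is bounded on \<open>X\<close> and \<open>X0\<close> is a nonempty subset of \<open>X\<close>, the set below is nonempty
  (take \<open>v\<close> constant) and bounded below, so its real infimum is the infimum in the usual sense. For
  empty \<open>X0\<close> the program is unbounded below and the real number \<open>Inf\<close> is unspecified.
\<close>

definition peak_value ::
  "real \<Rightarrow> (real^'n::finite) set \<Rightarrow> (real^'n) set \<Rightarrow> (real^'l::finite) set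
     \<Rightarrow> (real \<Rightarrow> real^'n \<Rightarrow> real^'n) \<Rightarrow> ('l \<Rightarrow> real \<Rightarrow> real^'n \<Rightarrow> real^'n)
     \<Rightarrow> (real^'n \<Rightarrow> real) \<Rightarrow> real" where
  "peak_value T X X0 W f0 f p = Inf {\<gamma>. \<exists>v. peak_feasible T X X0 W f0 f p v \<gamma>}"

end

theory Submission
  imports Defs
begin

text \<open>
  If \<open>v\<close> is feasible with value \<open>\<gamma> < d\<^sup>* + \<epsilon>/2\<close>, then \<open>u = v - (\<epsilon>/T) t + (3/2) \<epsilon>\<close> has Lie derivative at
  most \<open>-\<epsilon>/T\<close> and lies at least \<open>\<epsilon>/2\<close> above \<open>p\<close>, so every polynomial close enough to \<open>u\<close> in \<open>C\<^sup>1\<close> will do.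
  Such polynomials exist on any compact set \<open>K\<close>: on a fine grid, take a \<open>C\<^sup>1\<close> partition of unity
  \<open>\<phi>\<^sub>k\<close> by products of one-dimensional B-splines, and let \<open>T\<^sub>k\<close> be the first Taylor polynomial of \<open>u\<close> at a point
  of \<open>K\<close> in the \<open>k\<close>-th cell. The gradients of the \<open>\<phi>\<^sub>k\<close> grow like the inverse mesh size \<open>\<delta>\<^sup>-\<^sup>1\<close>, whereas
  \<open>u - T\<^sub>k\<close> is \<open>o(\<delta>)\<close> on the support of \<open>\<phi>\<^sub>k\<close>, so \<open>\<Sum>\<^sub>k \<phi>\<^sub>k T\<^sub>k\<close> tends to \<open>u\<close> in \<open>C\<^sup>1\<close>. It is itself a \<open>C\<^sup>1\<close> limit
  of polynomials, because the splines are, by integrating a Weierstrass approximation of their derivatives.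
\<close>

section \<open>Uniform limits and one-dimensional \<open>C1\<close> approximation by
  polynomials\<close>

lemma uniform_limit_bound:
  fixes P :: "nat \<Rightarrow> 'a \<Rightarrow> 'b::real_normed_vector"
  assumes "\<And>n x. x \<in> K \<Longrightarrow> norm (P n x - g x) \<le> c n" and "c \<longlonglongrightarrow> 0"
  shows "uniform_limit K P g sequentially"
proof (rule uniform_limitI)
  fix e :: real assume "e > 0"
  then have "\<forall>\<^sub>F n in sequentially. c n < e"
    using assms(2) by (auto intro: order_tendstoD)
  then show "\<forall>\<^sub>F n in sequentially. \<forall>x\<in>K. dist (P n x) (g x) < e"
    by eventually_elim (auto simp: dist_norm intro: le_less_trans[OF assms(1)])
qed

lemma real_polynomial_function_antiderivative:
  fixes p :: "real \<Rightarrow> real"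
  assumes "real_polynomial_function p"
  obtains q where "real_polynomial_function q" "\<And>x. (q has_real_derivative p x) (at x)"
proof -
  obtain a n where p: "p = (\<lambda>x. \<Sum>i\<le>n. a i * x ^ i)"
    using assms real_polynomial_function_iff_sum by blast
  show thesis
  proof
    show "real_polynomial_function (\<lambda>x. \<Sum>i\<le>n. (a i / (i + 1)) * x ^ (i + 1))"
      by (intro real_polynomial_function_sum real_polynomial_function.intros
          real_polynomial_function_power bounded_linear_ident) auto
    show "((\<lambda>x. \<Sum>i\<le>n. (a i / (i + 1)) * x ^ (i + 1)) has_real_derivative p x) (at x)" for x
    proof -
      have "((\<lambda>x. (a i / (i + 1)) * x ^ (i + 1)) has_real_derivative a i * x ^ i) (at x)" for i
        using DERIV_cmult[OF DERIV_pow[of "i + 1" x UNIV], of "a i / (i + 1)"] by simp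
      then show ?thesis
        unfolding p by (intro DERIV_sum)
    qed
  qed
qed

text \<open>Approximating \<open>h'\<close> and integrating controls both orders at once:
  \<open>q\<close> agrees with \<open>h\<close> at \<open>a\<close>, so the mean value inequality
  bounds \<open>q - h\<close> by the derivative error times \<open>b - a\<close>.\<close>

lemma C1_Weierstrass_real:
  fixes h h' :: "real \<Rightarrow> real"
  assumes "\<And>x. (h has_real_derivative h' x) (at x)" and "continuous_on UNIV h'"
    and "e > 0" and "a \<le> b"
  obtains q q' where "real_polynomial_function q" "\<And>x. (q has_real_derivative q' x) (at x)"
    "\<And>x. x \<in> {a..b} \<Longrightarrow> \<bar>q x - h x\<bar> \<le> e" "\<And>x. x \<in> {a..b} \<Longrightarrow> \<bar>q' x - h' x\<bar> \<le> e"
proof -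
  \<comment> \<open>Division by \<open>1 + (b - a)\<close> lets one number serve both errors:
    \<open>d\<close> itself for derivatives and \<open>d * (b - a)\<close> for values.\<close>
  define d where "d = e / (1 + (b - a))"
  have d: "d > 0" "d \<le> e" "d * (b - a) \<le> e"
    using assms(3,4) by (auto simp: d_def field_simps)
  obtain q' where q': "real_polynomial_function q'" "\<And>x. x \<in> {a..b} \<Longrightarrow> \<bar>h' x - q' x\<bar> < d"
    using Stone_Weierstrass_real_polynomial_function[of "{a..b}" h' d] assms(2) d
    by (metis compact_Icc continuous_on_subset subset_UNIV)
  obtain q0 where q0: "real_polynomial_function q0" "\<And>x. (q0 has_real_derivative q' x) (at x)"
    using real_polynomial_function_antiderivative[OF q'(1)] by blast
  define q where "q x = q0 x + (h a - q0 a)" for x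
  show thesis
  proof
    show "real_polynomial_function q"
      unfolding q_def using q0(1) by auto
    show q: "(q has_real_derivative q' x) (at x)" for x
      unfolding q_def by (auto intro!: derivative_eq_intros q0)
    show "\<bar>q' x - h' x\<bar> \<le> e" if "x \<in> {a..b}" for x
      using q'(2)[OF that] d by linarith
    fix x assume x: "x \<in> {a..b}"
    have "norm ((q x - h x) - (q a - h a)) \<le> d * norm (x - a)"
    proof (rule field_differentiable_bound[of "{a..b}" "\<lambda>x. q x - h x" "\<lambda>x. q' x - h' x"])
      show "((\<lambda>x. q x - h x) has_field_derivative q' z - h' z) (at z within {a..b})" for z
        by (intro DERIV_diff DERIV_subset[OF q] DERIV_subset[OF assms(1)]) auto
      show "norm (q' z - h' z) \<le> d" if "z \<in> {a..b}" for z
        using q'(2)[OF that] by simp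
    qed (use x in auto)
    also have "\<dots> \<le> d * (b - a)"
      using x d by (intro mult_left_mono) auto
    finally show "\<bar>q x - h x\<bar> \<le> e"
      using d by (simp add: q_def)
  qed
qed

section \<open>The algebra of \<open>C1\<close> limits of polynomials\<close>

text \<open>The set \<open>K\<close> may have empty interior, where \<open>g\<close> on
  \<open>K\<close> does not determine a derivative, so \<open>g'\<close> is carried as separate
  data. Boundedness is recorded because the product rule for uniform limits relies on it.\<close>

definition C1_polynomial_limit ::
  "'a::real_normed_vector set \<Rightarrow> ('a \<Rightarrow> real) \<Rightarrow> ('a \<Rightarrow> 'a \<Rightarrow>\<^sub>L real) \<Rightarrow> bool" where
  "C1_polynomial_limit K g g' \<longleftrightarrow> bounded (g ` K) \<and> bounded (g' ` K) \<and>
     (\<exists>P P'. (\<forall>n. real_polynomial_function (P n)) \<and>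
        (\<forall>n z. (P n has_derivative blinfun_apply (P' n z)) (at z)) \<and>
        uniform_limit K P g sequentially \<and> uniform_limit K P' g' sequentially)"

lemma C1_polynomial_limit_const: "C1_polynomial_limit K (\<lambda>_. c) (\<lambda>_. 0)"
  unfolding C1_polynomial_limit_def
  by (intro conjI exI[of _ "\<lambda>_ _. c"] exI[of _ "\<lambda>_ _. 0"] uniform_limit_const
      real_polynomial_function.intros allI has_derivative_eq_rhs[OF has_derivative_const])
    (auto simp: image_constant_conv)

lemma C1_polynomial_limit_linear:
  assumes "bounded K"
  shows "C1_polynomial_limit K (blinfun_apply L) (\<lambda>_. L)"
  unfolding C1_polynomial_limit_def
  using bounded_linear_image[OF assms blinfun.bounded_linear_right[of L]]
  by (auto intro!: exI[of _ "\<lambda>_. blinfun_apply L"] exI[of _ "\<lambda>_ _. L"] uniform_limit_const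
      bounded_linear_imp_has_derivative blinfun.bounded_linear_right real_polynomial_function.intros
      simp: image_constant_conv)

lemma C1_polynomial_limit_add:
  assumes "C1_polynomial_limit K g g'" and "C1_polynomial_limit K k k'"
  shows "C1_polynomial_limit K (\<lambda>z. g z + k z) (\<lambda>z. g' z + k' z)"
proof -
  obtain P P' where P: "\<And>n. real_polynomial_function (P n)"
    "\<And>n z. (P n has_derivative blinfun_apply (P' n z)) (at z)"
    "uniform_limit K P g sequentially" "uniform_limit K P' g' sequentially"
    using assms(1) unfolding C1_polynomial_limit_def by blast
  obtain Q Q' where Q: "\<And>n. real_polynomial_function (Q n)"
    "\<And>n z. (Q n has_derivative blinfun_apply (Q' n z)) (at z)"
    "uniform_limit K Q k sequentially" "uniform_limit K Q' k' sequentially"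
    using assms(2) unfolding C1_polynomial_limit_def by blast
  have "bounded ((\<lambda>z. g z + k z) ` K)" "bounded ((\<lambda>z. g' z + k' z) ` K)"
    using assms by (auto simp: C1_polynomial_limit_def intro!: bounded_plus_comp)
  then show ?thesis
    unfolding C1_polynomial_limit_def
    by (intro conjI exI[of _ "\<lambda>n z. P n z + Q n z"] exI[of _ "\<lambda>n z. P' n z + Q' n z"]
        uniform_limit_add P Q real_polynomial_function.intros(3) allI
        has_derivative_eq_rhs[OF has_derivative_add[OF P(2) Q(2)]])
      (auto simp: plus_blinfun.rep_eq)
qed

text \<open>Products of uniformly convergent sequences converge uniformly when the limits are
  bounded; the limit of the derivatives is then given by the product rule.\<close>

lemma C1_polynomial_limit_mult:
  assumes "C1_polynomial_limit K g g'" and "C1_polynomial_limit K k k'"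
  shows "C1_polynomial_limit K (\<lambda>z. g z * k z) (\<lambda>z. g z *\<^sub>R k' z + k z *\<^sub>R g' z)"
proof -
  obtain P P' where P: "\<And>n. real_polynomial_function (P n)"
    "\<And>n z. (P n has_derivative blinfun_apply (P' n z)) (at z)"
    "uniform_limit K P g sequentially" "uniform_limit K P' g' sequentially"
    and g: "bounded (g ` K)" "bounded (g' ` K)"
    using assms(1) unfolding C1_polynomial_limit_def by blast
  obtain Q Q' where Q: "\<And>n. real_polynomial_function (Q n)"
    "\<And>n z. (Q n has_derivative blinfun_apply (Q' n z)) (at z)"
    "uniform_limit K Q k sequentially" "uniform_limit K Q' k' sequentially"
    and k: "bounded (k ` K)" "bounded (k' ` K)"
    using assms(2) unfolding C1_polynomial_limit_def by blast
  have bm: "bounded ((\<lambda>z. a z *\<^sub>R b z) ` K)"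
    if "bounded (a ` K)" "bounded (b ` K)" for a :: "'a \<Rightarrow> real" and b :: "'a \<Rightarrow> 'b::real_normed_vector"
  proof -
    obtain A B where "\<And>z. z \<in> K \<Longrightarrow> norm (a z) \<le> A" "\<And>z. z \<in> K \<Longrightarrow> norm (b z) \<le> B"
      using \<open>bounded (a ` K)\<close> \<open>bounded (b ` K)\<close> by (auto simp: bounded_iff)
    then show ?thesis
      unfolding bounded_iff
      by (intro exI[of _ "A * B"]) (auto intro!: mult_mono intro: order_trans[OF abs_ge_zero])
  qed
  have "bounded ((\<lambda>z. g z * k z) ` K)" "bounded ((\<lambda>z. g z *\<^sub>R k' z + k z *\<^sub>R g' z) ` K)"
    using bm[OF g(1) k(1)] by (auto intro!: bounded_plus_comp bm g k)
  moreover have "((\<lambda>z. P n z * Q n z) has_derivative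
        blinfun_apply (P n z *\<^sub>R Q' n z + Q n z *\<^sub>R P' n z)) (at z)" for n z
    by (rule has_derivative_eq_rhs[OF has_derivative_mult[OF P(2) Q(2)]])
      (simp add: plus_blinfun.rep_eq scaleR_blinfun.rep_eq fun_eq_iff)
  ultimately show ?thesis
    unfolding C1_polynomial_limit_def
    by (intro conjI exI[of _ "\<lambda>n z. P n z * Q n z"]
        exI[of _ "\<lambda>n z. P n z *\<^sub>R Q' n z + Q n z *\<^sub>R P' n z"] allI
        uniform_limit_add uniform_lim_mult
        bounded_bilinear.bounded_uniform_limit[OF bounded_bilinear_scaleR]
        P Q g k real_polynomial_function.intros(4))
qed

lemma C1_polynomial_limit_sum:
  assumes "finite I" and "\<And>i. i \<in> I \<Longrightarrow> C1_polynomial_limit K (g i) (g' i)"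
  shows "C1_polynomial_limit K (\<lambda>z. \<Sum>i\<in>I. g i z) (\<lambda>z. \<Sum>i\<in>I. g' i z)"
  using assms
  by (induction I rule: finite_induct)
    (auto intro: C1_polynomial_limit_const C1_polynomial_limit_add)

text \<open>The derivative is written with one factor left out at a time, the form in which
  \<open>has_derivative_prod\<close> later delivers the gradient of a product of splines.\<close>

lemma C1_polynomial_limit_prod:
  assumes "finite I" and "\<And>i. i \<in> I \<Longrightarrow> C1_polynomial_limit K (g i) (g' i)"
  shows "C1_polynomial_limit K (\<lambda>z. \<Prod>i\<in>I. g i z)
           (\<lambda>z. \<Sum>i\<in>I. (\<Prod>j\<in>I - {i}. g j z) *\<^sub>R g' i z)"
  using assms
proof (induction I rule: finite_induct)
  case empty
  then show ?case by (simp add: C1_polynomial_limit_const)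
next
  case (insert a I)
  have "(\<Prod>j\<in>insert a I - {i}. g j z) = g a z * (\<Prod>j\<in>I - {i}. g j z)" if "i \<in> I" for i z
  proof -
    have "insert a I - {i} = insert a (I - {i})" using that insert by auto
    then show ?thesis using insert by simp
  qed
  moreover have "insert a I - {a} = I" using insert by auto
  moreover have "C1_polynomial_limit K (\<lambda>z. g a z * (\<Prod>i\<in>I. g i z))
     (\<lambda>z. g a z *\<^sub>R (\<Sum>i\<in>I. (\<Prod>j\<in>I - {i}. g j z) *\<^sub>R g' i z) + (\<Prod>i\<in>I. g i z) *\<^sub>R g' a z)"
    using insert by (intro C1_polynomial_limit_mult) auto
  ultimately show ?case
    using insert by (simp add: scaleR_sum_right add.commute)
qed

section \<open>Functions of a single linear coordinate\<close>

lemma has_derivative_ridge: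
  fixes h h' :: "real \<Rightarrow> real"
  assumes "\<And>x. (h has_real_derivative h' x) (at x)"
  shows "((\<lambda>z. h (z \<bullet> c)) has_derivative blinfun_apply (h' (z \<bullet> c) *\<^sub>R blinfun_inner_left c)) (at z)"
proof -
  have "((\<lambda>z. z \<bullet> c) has_derivative (\<lambda>y. y \<bullet> c)) (at z)"
    by (auto intro!: derivative_eq_intros)
  from has_derivative_compose[OF this assms[unfolded has_field_derivative_def]]
  show ?thesis
    by (rule has_derivative_eq_rhs) (simp add: scaleR_blinfun.rep_eq fun_eq_iff)
qed

text \<open>The functional \<open>z \<bullet> c\<close> maps the bounded set \<open>K\<close> into a
  compact interval, so one-dimensional approximation there suffices; a univariate polynomial of a
  linear functional is again a polynomial.\<close>

lemma C1_polynomial_limit_ridge: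
  fixes c :: "'a::euclidean_space" and h h' :: "real \<Rightarrow> real"
  assumes K: "bounded K"
    and h: "\<And>x. (h has_real_derivative h' x) (at x)" "continuous_on UNIV h'"
  shows "C1_polynomial_limit K (\<lambda>z. h (z \<bullet> c)) (\<lambda>z. h' (z \<bullet> c) *\<^sub>R blinfun_inner_left c)"
proof -
  have "bounded ((\<lambda>z. z \<bullet> c) ` K)"
    using K by (intro bounded_linear_image bounded_linear_inner_left)
  then obtain a where a: "\<And>z. z \<in> K \<Longrightarrow> \<bar>z \<bullet> c\<bar> \<le> a" and "a \<ge> 0"
    by (auto simp: bounded_pos) (meson less_imp_le)
  then have in_I: "z \<bullet> c \<in> {-a..a}" if "z \<in> K" for z
    using a[OF that] by auto
  have "\<exists>q q'. real_polynomial_function q \<and> (\<forall>x. (q has_real_derivative q' x) (at x)) \<and>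
      (\<forall>x\<in>{-a..a}. \<bar>q x - h x\<bar> \<le> inverse (real (Suc n))) \<and>
      (\<forall>x\<in>{-a..a}. \<bar>q' x - h' x\<bar> \<le> inverse (real (Suc n)))" for n
  proof -
    have "inverse (real (Suc n)) > 0" "-a \<le> a" using \<open>a \<ge> 0\<close> by auto
    from C1_Weierstrass_real[OF h this] show ?thesis by metis
  qed
  then obtain q q' where q: "\<And>n. real_polynomial_function (q n)"
      "\<And>n x. (q n has_real_derivative q' n x) (at x)"
      "\<And>n x. x\<in>{-a..a} \<Longrightarrow> \<bar>q n x - h x\<bar> \<le> inverse (real (Suc n))"
      "\<And>n x. x\<in>{-a..a} \<Longrightarrow> \<bar>q' n x - h' x\<bar> \<le> inverse (real (Suc n))"
    by metis
  define L where "L = (blinfun_inner_left c :: 'a \<Rightarrow>\<^sub>L real)"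
  have "continuous_on {-a..a} h"
    using h(1) by (meson DERIV_isCont continuous_at_imp_continuous_on)
  then have "bounded (h ` {-a..a})" "bounded (h' ` {-a..a})"
    using h(2) by (auto intro!: compact_imp_bounded compact_continuous_image
        intro: continuous_on_subset)
  then obtain B B' where B: "\<And>x. x \<in> {-a..a} \<Longrightarrow> \<bar>h x\<bar> \<le> B" "\<And>x. x \<in> {-a..a} \<Longrightarrow> \<bar>h' x\<bar> \<le> B'"
    unfolding bounded_iff real_norm_def by blast
  have "bounded ((\<lambda>z. h (z \<bullet> c)) ` K)"
    unfolding bounded_iff by (intro exI[of _ B]) (auto intro!: B in_I simp del: atLeastAtMost_iff)
  moreover have "bounded ((\<lambda>z. h' (z \<bullet> c) *\<^sub>R L) ` K)"
    unfolding bounded_iff by (intro exI[of _ "B' * norm L"])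
      (auto intro!: mult_right_mono B in_I simp del: atLeastAtMost_iff)
  moreover have "real_polynomial_function (\<lambda>z. q n (z \<bullet> c))" for n
  proof -
    have "polynomial_function (\<lambda>z::'a. z \<bullet> c)"
      using bounded_linear_inner_left real_polynomial_function_eq by blast
    from real_polynomial_function_compose[OF this q(1)] show ?thesis
      by (simp add: o_def)
  qed
  moreover have "((\<lambda>z. q n (z \<bullet> c)) has_derivative blinfun_apply (q' n (z \<bullet> c) *\<^sub>R L)) (at z)" for n z
    unfolding L_def using q(2) by (rule has_derivative_ridge)
  moreover have "uniform_limit K (\<lambda>n z. q n (z \<bullet> c)) (\<lambda>z. h (z \<bullet> c)) sequentially"
    using q(3)[OF in_I] by (intro uniform_limit_bound[OF _ LIMSEQ_inverse_real_of_nat]) simp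
  moreover have "uniform_limit K (\<lambda>n z. q' n (z \<bullet> c) *\<^sub>R L) (\<lambda>z. h' (z \<bullet> c) *\<^sub>R L) sequentially"
  proof (rule uniform_limit_bound)
    show "norm (q' n (z \<bullet> c) *\<^sub>R L - h' (z \<bullet> c) *\<^sub>R L) \<le> inverse (real (Suc n)) * norm L"
      if "z \<in> K" for n z
      using q(4)[OF in_I[OF that], of n]
      by (simp add: mult_right_mono flip: scaleR_diff_left del: of_nat_Suc)
    show "(\<lambda>n. inverse (real (Suc n)) * norm L) \<longlonglongrightarrow> 0"
      using tendsto_mult_left_zero[OF LIMSEQ_inverse_real_of_nat] by blast
  qed
  ultimately show ?thesis
    unfolding C1_polynomial_limit_def L_def by (intro conjI exI allI)
qed

section \<open>A \<open>C1\<close> spline and its integer translates\<close>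

text \<open>The quadratic B-spline with knots \<open>0, 1, 2, 3\<close>.\<close>

definition bump :: "real \<Rightarrow> real" where
  "bump x = ((max 0 x)\<^sup>2 - 3 * (max 0 (x - 1))\<^sup>2 + 3 * (max 0 (x - 2))\<^sup>2 - (max 0 (x - 3))\<^sup>2) / 2"

text \<open>Continuous and piecewise linear, with slopes 1, -2, 1 between the knots and extreme
  values 1 and -1 at the inner knots.\<close>

definition bump' :: "real \<Rightarrow> real" where
  "bump' x = max 0 x - 3 * max 0 (x - 1) + 3 * max 0 (x - 2) - max 0 (x - 3)"

text \<open>Only the origin needs care: the difference quotient there is \<open>max 0 y\<close>,
  which tends to 0. Elsewhere the function agrees with a polynomial on an open half-line.\<close>

lemma has_real_derivative_max_0_power2:
  "((\<lambda>x::real. (max 0 x)\<^sup>2) has_real_derivative 2 * max 0 x) (at x)"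
proof (cases "x = 0")
  case True
  have "((\<lambda>y::real. max 0 y) \<longlongrightarrow> max 0 0) (at 0)"
    by (intro tendsto_intros)
  moreover have "\<forall>\<^sub>F y in at (0::real). ((max 0 y)\<^sup>2 - (max 0 0)\<^sup>2) / (y - 0) = max 0 y"
    by (auto simp: eventually_at_filter max_def power2_eq_square)
  ultimately show ?thesis
    using True by (simp add: has_field_derivative_iff tendsto_cong)
next
  case False
  then consider "x > 0" | "x < 0" by linarith
  then show ?thesis
  proof cases
    case 1
    have "((\<lambda>x::real. x\<^sup>2) has_real_derivative 2 * x) (at x)"
      by (auto intro!: derivative_eq_intros)
    then show ?thesis
      using 1 by (auto intro: has_field_derivative_transform_within_open[of _ _ x "{0<..}"])
  next
    case 2
    have "((\<lambda>x::real. 0) has_real_derivative 0) (at x)"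
      by (auto intro!: derivative_eq_intros)
    then show ?thesis
      using 2 has_field_derivative_transform_within_open
        [of "\<lambda>x. 0" 0 x "{..<0}" "\<lambda>x::real. (max 0 x)\<^sup>2"] by auto
  qed
qed

lemma has_real_derivative_bump: "(bump has_real_derivative bump' x) (at x)"
proof -
  have shift: "((\<lambda>x::real. (max 0 (x - a))\<^sup>2) has_real_derivative 2 * max 0 (x - a)) (at x)" for a
    proof -
    have "((\<lambda>x. x - a) has_real_derivative 1) (at x)"
      by (auto intro!: derivative_eq_intros)
    from DERIV_chain2[OF has_real_derivative_max_0_power2 this] show ?thesis by simp
  qed
  have "(bump has_real_derivative (2 * max 0 x - 3 * (2 * max 0 (x - 1))
      + 3 * (2 * max 0 (x - 2)) - 2 * max 0 (x - 3)) / 2) (at x)"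
    unfolding bump_def[abs_def]
    by (intro DERIV_cdivide DERIV_diff DERIV_add DERIV_cmult shift has_real_derivative_max_0_power2)
  then show ?thesis
    by (rule DERIV_cong) (simp add: bump'_def)
qed

lemma continuous_on_bump': "continuous_on S bump'"
  unfolding bump'_def by (intro continuous_intros)

text \<open>A \<open>C1\<close> step from 0 to 1, the integral of the hat function on the interval
  from 0 to 2. The spline is its backward difference, so sums of integer translates
  telescope.\<close>

definition ramp :: "real \<Rightarrow> real" where
  "ramp x = ((max 0 x)\<^sup>2 - 2 * (max 0 (x - 1))\<^sup>2 + (max 0 (x - 2))\<^sup>2) / 2"

lemma bump_eq_ramp_diff: "bump x = ramp x - ramp (x - 1)"
  by (simp add: bump_def ramp_def field_simps)

lemma ramp_eq_0: "x \<le> 0 \<Longrightarrow> ramp x = 0"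
  by (simp add: ramp_def)

lemma ramp_eq_1: "x \<ge> 2 \<Longrightarrow> ramp x = 1"
  by (simp add: ramp_def max_def power2_eq_square algebra_simps)

text \<open>The two middle pieces are parabolas, related by the point reflection that exchanges
  \<open>x\<close> with \<open>2 - x\<close> and the value with its complement to 1.\<close>

lemma ramp_bounds: "0 \<le> ramp x \<and> ramp x \<le> 1"
proof -
  consider "x \<le> 0" | "0 \<le> x" "x \<le> 1" | "1 \<le> x" "x \<le> 2" | "2 \<le> x" by linarith
  then show ?thesis
  proof cases
    case 2
    then have "ramp x = x\<^sup>2 / 2" "x\<^sup>2 \<le> 1"
      by (simp add: ramp_def, simp add: power_le_one)
    then show ?thesis using zero_le_power2[of x] by linarith
  next
    case 3
    then have "ramp x = 1 - (2 - x)\<^sup>2 / 2" "(2 - x)\<^sup>2 \<le> 1"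
      by (simp add: ramp_def power2_eq_square field_simps, simp add: power_le_one)
    then show ?thesis using zero_le_power2[of "2 - x"] by linarith
  qed (simp_all add: ramp_eq_0 ramp_eq_1)
qed

lemma abs_bump_le: "\<bar>bump x\<bar> \<le> 1"
  using ramp_bounds[of x] ramp_bounds[of "x - 1"] by (auto simp: bump_eq_ramp_diff)

lemma bump_eq_0: "x \<notin> {0..3} \<Longrightarrow> bump x = 0"
  by (auto simp: bump_eq_ramp_diff ramp_eq_0 ramp_eq_1)

lemma bump'_eq_0: "x \<notin> {0..3} \<Longrightarrow> bump' x = 0"
  by (auto simp: bump'_def max_def)

lemma abs_bump'_le: "\<bar>bump' x\<bar> \<le> 1"
  by (auto simp: bump'_def max_def)

text \<open>By \<open>bump_eq_ramp_diff\<close> consecutive translates cancel, leaving only the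
  ramps at the two ends.\<close>

lemma sum_bump_shift:
  fixes a b :: int and x :: real
  assumes "a \<le> b"
  shows "(\<Sum>m\<in>{a..b}. bump (x - real_of_int m)) = ramp (x - real_of_int a) - ramp (x - real_of_int b - 1)"
  using assms
proof (induction b rule: int_ge_induct)
  case base
  then show ?case by (simp add: bump_eq_ramp_diff)
next
  case (step b)
  then have "{a..b + 1} = insert (b + 1) {a..b}" by auto
  with step show ?case by (simp add: bump_eq_ramp_diff algebra_simps)
qed

text \<open>The margin 2 puts the first end ramp at an argument at least 2, where it is 1, and the
  other at a negative argument, where it is 0.\<close>

lemma sum_bump_eq_1:
  fixes N :: int and x :: real
  assumes "\<bar>x\<bar> + 2 \<le> real_of_int N"
  shows "(\<Sum>m\<in>{-N..N}. bump (x - real_of_int m)) = 1"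
  using assms by (subst sum_bump_shift) (auto simp: ramp_eq_0 ramp_eq_1)

section \<open>Uniform Taylor estimate and counting of cells\<close>

lemma norm_blinfun_inner_left_le: "norm (blinfun_inner_left c) \<le> norm c"
  using Cauchy_Schwarz_ineq2 by (intro norm_blinfun_bound) (auto simp: mult.commute)

text \<open>Nothing makes \<open>K\<close> convex, so the mean value inequality is applied in balls
  inside \<open>U\<close> instead. Compactness makes one radius \<open>\<delta>\<close> work for all
  points of \<open>K\<close>.\<close>

lemma uniform_C1_Taylor:
  fixes v :: "'a::euclidean_space \<Rightarrow> real" and v' :: "'a \<Rightarrow> 'a \<Rightarrow>\<^sub>L real"
  assumes "compact K" and "open U" and "K \<subseteq> U"
    and v: "\<And>z. z \<in> U \<Longrightarrow> (v has_derivative blinfun_apply (v' z)) (at z)"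
    and cont: "continuous_on U v'" and "\<eta> > 0"
  obtains \<delta> where "\<delta> > 0"
    "\<And>c z. \<lbrakk>c \<in> K; z \<in> K; norm (z - c) < \<delta>\<rbrakk> \<Longrightarrow>
        \<bar>v z - v c - v' c (z - c)\<bar> \<le> \<eta> * norm (z - c) \<and> norm (v' z - v' c) \<le> \<eta>"
proof -
  \<comment> \<open>Half of \<open>\<eta>\<close> is allowed from the centre, so that
    \<open>v'\<close> varies by at most \<open>\<eta>\<close> between any two points of such a
    ball.\<close>
  define \<G> where "\<G> = {ball c r | c r. ball c r \<subseteq> U \<and> (\<forall>z\<in>ball c r. norm (v' z - v' c) \<le> \<eta> / 2)}"
  have "K \<subseteq> \<Union>\<G>"
  proof
    fix c assume "c \<in> K"
    then have c: "c \<in> U" using assms by auto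
    obtain r1 where r1: "r1 > 0" "ball c r1 \<subseteq> U"
      using \<open>open U\<close> c openE by blast
    have "isCont v' c"
      using cont \<open>open U\<close> c continuous_on_eq_continuous_at by blast
    then obtain r2 where r2: "r2 > 0" "\<And>z. dist z c < r2 \<Longrightarrow> dist (v' z) (v' c) < \<eta> / 2"
      using \<open>\<eta> > 0\<close> unfolding continuous_at_eps_delta by (metis half_gt_zero)
    have "ball c (min r1 r2) \<in> \<G>"
      unfolding \<G>_def using r1 r2
      by (intro CollectI exI[of _ c] exI[of _ "min r1 r2"])
        (auto simp: dist_commute dist_norm[symmetric] intro: less_imp_le)
    moreover have "c \<in> ball c (min r1 r2)" using r1 r2 by auto
    ultimately show "c \<in> \<Union>\<G>" by blast
  qed
  moreover have "\<And>G. G \<in> \<G> \<Longrightarrow> open G" by (auto simp: \<G>_def)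
  \<comment> \<open>Here \<open>\<delta>\<close> is a Lebesgue number of the cover: points of
    \<open>K\<close> closer than \<open>\<delta>\<close> share a ball.\<close>
  ultimately obtain \<delta> where \<delta>: "\<delta> > 0" "\<And>x. x \<in> K \<Longrightarrow> \<exists>G\<in>\<G>. ball x \<delta> \<subseteq> G"
    using Heine_Borel_lemma[OF \<open>compact K\<close>, of \<G>] by blast
  show thesis
  proof (rule that[OF \<delta>(1)])
    fix c z assume c: "c \<in> K" "z \<in> K" "norm (z - c) < \<delta>"
    obtain c0 r where G: "ball c \<delta> \<subseteq> ball c0 r" "ball c0 r \<subseteq> U"
      "\<And>y. y \<in> ball c0 r \<Longrightarrow> norm (v' y - v' c0) \<le> \<eta> / 2"
      using \<delta>(2)[OF c(1)] unfolding \<G>_def by blast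
    have in_G: "c \<in> ball c0 r" "z \<in> ball c0 r"
      using c \<delta>(1) subsetD[OF G(1), of c] subsetD[OF G(1), of z]
      by (auto simp: dist_norm norm_minus_commute)
    have *: "norm (v' y - v' c) \<le> \<eta>" if "y \<in> ball c0 r" for y
      using G(3)[OF that] G(3)[OF in_G(1)] norm_triangle_ineq4[of "v' y - v' c0" "v' c - v' c0"]
      by simp
    have "norm (v z - v c - blinfun_apply (v' c) (z - c)) \<le> norm (z - c) * \<eta>"
    proof (rule differentiable_bound_linearization[where S = "ball c0 r" and f' = "\<lambda>x. blinfun_apply (v' x)"])
      show "c + t *\<^sub>R (z - c) \<in> ball c0 r" if "t \<in> {0..1}" for t
        using convexD_alt[OF convex_ball in_G, of t] that by (simp add: algebra_simps)
      show "(v has_derivative blinfun_apply (v' x)) (at x within ball c0 r)" if "x \<in> ball c0 r" for x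
        using v[of x] G(2) that has_derivative_at_withinI by blast
      show "onorm (blinfun_apply (v' x) - blinfun_apply (v' c)) \<le> \<eta>" if "x \<in> ball c0 r" for x
        using *[OF that] by (simp add: norm_blinfun.rep_eq minus_blinfun.rep_eq fun_diff_def)
    qed (fact in_G)
    then show "\<bar>v z - v c - v' c (z - c)\<bar> \<le> \<eta> * norm (z - c) \<and> norm (v' z - v' c) \<le> \<eta>"
      using *[OF in_G(2)] by (simp add: mult.commute)
  qed
qed

text \<open>The support of \<open>bump\<close> has length 3, so at most four translates per
  coordinate matter at a given point.\<close>

lemma card_int_window: "card {m. x - 3 \<le> real_of_int m \<and> real_of_int m \<le> x} \<le> 4" "finite {m. x - 3 \<le> real_of_int m \<and> real_of_int m \<le> x}"
proof -
  have "{m. x - 3 \<le> real_of_int m \<and> real_of_int m \<le> x} = {\<lceil>x - 3\<rceil>..\<lfloor>x\<rfloor>}"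
    unfolding set_eq_iff atLeastAtMost_iff mem_Collect_eq ceiling_le_iff le_floor_iff by blast
  moreover have "nat (\<lfloor>x\<rfloor> - \<lceil>x - 3\<rceil> + 1) \<le> 4" by linarith
  ultimately show "card {m. x - 3 \<le> real_of_int m \<and> real_of_int m \<le> x} \<le> 4" "finite {m. x - 3 \<le> real_of_int m \<and> real_of_int m \<le> x}"
    by (simp_all add: nat_le_iff)
qed

section \<open>Polynomial approximation in \<open>C1\<close> on compact sets\<close>

theorem C1_Weierstrass:
  fixes v :: "'a::euclidean_space \<Rightarrow> real" and v' :: "'a \<Rightarrow> 'a \<Rightarrow>\<^sub>L real"
  assumes "compact K" and "open U" and "K \<subseteq> U"
    and v: "\<And>z. z \<in> U \<Longrightarrow> (v has_derivative blinfun_apply (v' z)) (at z)"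
    and cont: "continuous_on U v'" and "e > 0"
  obtains P P' where "real_polynomial_function P"
    "\<And>z. (P has_derivative blinfun_apply (P' z)) (at z)"
    "\<And>z. z \<in> K \<Longrightarrow> \<bar>P z - v z\<bar> \<le> e" "\<And>z. z \<in> K \<Longrightarrow> norm (P' z - v' z) \<le> e"
proof -
  \<comment> \<open>The dimension \<open>J\<close> enters through the comparison with the
    \<open>l1\<close> norm and the number of terms in a gradient; \<open>M\<close> bounds the number
    of cells near a point.\<close>
  define J where "J = real DIM('a)"
  have J: "J \<ge> 1" by (simp add: J_def Suc_leI)
  define M :: real where "M = 4 ^ DIM('a)"
  have M: "M > 0" by (simp add: M_def)
  \<comment> \<open>The summands 1, \<open>3 * J\<close> and \<open>3 * J\<^sup>2\<close> account
    for the errors of the derivatives \<open>v' (c k)\<close>, of the Taylor values, and of the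
    Taylor values multiplied by gradients. The sum leaves half of \<open>e\<close> for the final
    polynomial.\<close>
  define \<eta> where "\<eta> = e / (2 * (M * (1 + 3 * J + 3 * J\<^sup>2)))"
  have pos: "1 + 3 * J + 3 * J\<^sup>2 > 0" using J by (intro add_pos_nonneg) auto
  have \<eta>: "\<eta> > 0" "M * (\<eta> * (1 + 3 * J + 3 * J\<^sup>2)) = e / 2"
    using \<open>e > 0\<close> M pos by (auto simp: \<eta>_def)
  obtain \<delta>0 where \<delta>0: "\<delta>0 > 0"
    "\<And>c z. \<lbrakk>c \<in> K; z \<in> K; norm (z - c) < \<delta>0\<rbrakk> \<Longrightarrow>
        \<bar>v z - v c - v' c (z - c)\<bar> \<le> \<eta> * norm (z - c) \<and> norm (v' z - v' c) \<le> \<eta>"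
    using uniform_C1_Taylor[OF assms(1-5) \<eta>(1)] by metis
  \<comment> \<open>Points of one cell are at most \<open>3 * J * \<delta>\<close> apart; the 4
    makes this strictly less than \<open>\<delta>0\<close>. The cap 1 is for the estimate of the
    values.\<close>
  define \<delta> where "\<delta> = min 1 (\<delta>0 / (4 * J))"
  have \<delta>: "\<delta> > 0" "\<delta> \<le> 1" "3 * J * \<delta> < \<delta>0"
  proof -
    show "\<delta> > 0" "\<delta> \<le> 1" using \<delta>0 J by (auto simp: \<delta>_def)
    have "\<delta> \<le> \<delta>0 / (4 * J)" by (simp add: \<delta>_def)
    then have "4 * (J * \<delta>) \<le> \<delta>0" using J by (simp add: field_simps)
    moreover have "J * \<delta> > 0" using J \<open>\<delta> > 0\<close> by simp
    ultimately show "3 * J * \<delta> < \<delta>0" by linarith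
  qed
  obtain R where R: "K \<subseteq> ball 0 R"
    using compact_imp_bounded[OF \<open>compact K\<close>] bounded_subset_ballD by blast
  \<comment> \<open>Scaled coordinates on \<open>ball 0 R\<close> are at most
    \<open>R / \<delta>\<close>; the 2 is the margin of \<open>sum_bump_eq_1\<close>.\<close>
  define N where "N = \<lceil>R / \<delta> + 2\<rceil>"
  \<comment> \<open>Coordinates in units of the mesh size, written as inner products with a fixed
    vector so that the splines are ridge functions.\<close>
  define y where "y b z = z \<bullet> (b /\<^sub>R \<delta>)" for b z :: 'a
  have y_eq: "y b z = (z \<bullet> b) / \<delta>" for b z by (simp add: y_def divide_inverse mult.commute)
  define I where "I = PiE (Basis::'a set) (\<lambda>_. {-N..N})"
  have "finite I" unfolding I_def by (intro finite_PiE) auto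
  define \<phi> where "\<phi> k z = (\<Prod>b\<in>Basis. bump (y b z - real_of_int (k b)))" for k and z :: 'a
  define \<psi>' where "\<psi>' k b z = bump' (y b z - real_of_int (k b)) *\<^sub>R blinfun_inner_left (b /\<^sub>R \<delta>)"
    for k and b z :: 'a
  define \<phi>' where "\<phi>' k z = (\<Sum>b\<in>Basis. (\<Prod>j\<in>Basis - {b}. bump (y j z - real_of_int (k j))) *\<^sub>R \<psi>' k b z)"
    for k and z :: 'a
  \<comment> \<open>This describes the closed box of side \<open>3 * \<delta>\<close> outside which
    \<open>\<phi> k\<close> vanishes.\<close>
  define near where "near z k \<longleftrightarrow> (\<forall>b\<in>Basis. y b z - 3 \<le> real_of_int (k b) \<and> real_of_int (k b) \<le> y b z)"
    for k and z :: 'a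
  define c where "c k = (SOME c. c \<in> K \<and> near c k)" for k
  \<comment> \<open>For indices \<open>k\<close> whose cell misses \<open>K\<close>, the point \<open>c k\<close> is arbitrary: there \<open>\<phi> k\<close> vanishes on \<open>K\<close>.\<close>
  define T where "T k z = v (c k) - v' (c k) (c k) + v' (c k) z" for k z

  have shift: "((\<lambda>x. bump (x - r)) has_real_derivative bump' (x - r)) (at x)" for x r
    using DERIV_shift[of bump "bump' (x - r)" x "-r"] has_real_derivative_bump by simp
  have \<phi>_deriv: "(\<phi> k has_derivative blinfun_apply (\<phi>' k z)) (at z)" for k z
  proof -
    have "((\<lambda>z. bump (y b z - real_of_int (k b))) has_derivative blinfun_apply (\<psi>' k b z)) (at z)" for b
      unfolding y_def \<psi>'_def by (rule has_derivative_ridge[OF shift])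
    from has_derivative_prod[where I = Basis, OF this]
    show ?thesis
      unfolding \<phi>_def[abs_def] \<phi>'_def
      by (rule has_derivative_eq_rhs)
        (simp add: fun_eq_iff blinfun.sum_left scaleR_blinfun.rep_eq mult.commute)
  qed
  have \<phi>_limit: "C1_polynomial_limit K (\<phi> k) (\<phi>' k)" for k
    unfolding \<phi>_def[abs_def] \<phi>'_def[abs_def] \<psi>'_def y_def
    by (intro C1_polynomial_limit_prod C1_polynomial_limit_ridge shift compact_imp_bounded assms
        finite_Basis continuous_on_compose2[OF continuous_on_bump'[of UNIV]] continuous_intros) auto
  have T_limit: "C1_polynomial_limit K (T k) (\<lambda>_. v' (c k))" for k
    using C1_polynomial_limit_add[OF C1_polynomial_limit_const C1_polynomial_limit_linear]
      compact_imp_bounded[OF \<open>compact K\<close>] by (fastforce simp: T_def[abs_def])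
  define g where "g z = (\<Sum>k\<in>I. \<phi> k z * T k z)" for z
  define g' where "g' z = (\<Sum>k\<in>I. \<phi> k z *\<^sub>R v' (c k) + T k z *\<^sub>R \<phi>' k z)" for z
  have g_limit: "C1_polynomial_limit K g g'"
    unfolding g_def[abs_def] g'_def[abs_def]
    by (intro C1_polynomial_limit_sum C1_polynomial_limit_mult \<phi>_limit T_limit \<open>finite I\<close>)

  \<comment> \<open>Each coordinate sum of splines is 1; expanding their product gives one term for
    every \<open>k\<close> in \<open>I\<close>.\<close>
  have sum_\<phi>: "(\<Sum>k\<in>I. \<phi> k z) = 1" if "z \<in> ball 0 R" for z
  proof -
    have "\<bar>y b z\<bar> + 2 \<le> real_of_int N" if "b \<in> Basis" for b
    proof -
      have "\<bar>z \<bullet> b\<bar> \<le> R"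
        using Basis_le_norm[OF that, of z] \<open>z \<in> ball 0 R\<close> by simp
      then have "\<bar>y b z\<bar> \<le> R / \<delta>"
        using \<delta> by (simp add: y_eq divide_right_mono)
      then show ?thesis unfolding N_def by linarith
    qed
    then have "(\<Prod>b\<in>(Basis::'a set). \<Sum>m\<in>{-N..N}. bump (y b z - real_of_int m)) = 1"
      by (simp add: sum_bump_eq_1)
    then show ?thesis
      unfolding \<phi>_def I_def by (subst (asm) prod_sum_PiE) auto
  qed
  \<comment> \<open>Differentiating the identity needs it on an open set, hence on
    \<open>ball 0 R\<close> rather than only on \<open>K\<close>.\<close>
  have sum_\<phi>': "(\<Sum>k\<in>I. \<phi>' k z) = 0" if "z \<in> ball 0 R" for z
  proof -
    have "((\<lambda>z. \<Sum>k\<in>I. \<phi> k z) has_derivative (\<lambda>h. \<Sum>k\<in>I. \<phi>' k z h)) (at z)"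
      by (intro has_derivative_sum \<phi>_deriv)
    moreover have "((\<lambda>z. \<Sum>k\<in>I. \<phi> k z) has_derivative (\<lambda>h. 0)) (at z)"
      by (rule has_derivative_transform_within_open[OF has_derivative_const[of 1] open_ball that])
        (simp add: sum_\<phi>)
    ultimately have "(\<lambda>h. \<Sum>k\<in>I. \<phi>' k z h) = (\<lambda>h. 0)"
      by (rule has_derivative_unique)
    then show ?thesis
      by (intro blinfun_eqI) (simp add: blinfun.sum_left fun_eq_iff)
  qed
  \<comment> \<open>In a direction \<open>b\<close> where \<open>z\<close> leaves the box, every
    term of the gradient keeps a vanishing factor: \<open>bump'\<close> in the term for
    \<open>b\<close>, \<open>bump\<close> in all others.\<close>
  have far: "\<phi> k z = 0 \<and> \<phi>' k z = 0" if not_near: "\<not> near z k" for k z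
  proof -
    obtain b where "b \<in> Basis" "\<not> (y b z - 3 \<le> real_of_int (k b) \<and> real_of_int (k b) \<le> y b z)"
      using not_near unfolding near_def by blast
    then have b: "b \<in> Basis" "y b z - real_of_int (k b) \<notin> {0..3}" by auto
    have "(\<Prod>j\<in>Basis - {i}. bump (y j z - real_of_int (k j))) *\<^sub>R \<psi>' k i z = 0" for i
    proof (cases "i = b")
      case True
      then show ?thesis using bump'_eq_0[OF b(2)] by (simp add: \<psi>'_def)
    next
      case False
      then have "(\<Prod>j\<in>Basis - {i}. bump (y j z - real_of_int (k j))) = 0"
        using b bump_eq_0[OF b(2)] by (intro prod_zero) auto
      then show ?thesis by simp
    qed
    moreover have "\<phi> k z = 0"
      unfolding \<phi>_def using b bump_eq_0[OF b(2)] by (intro prod_zero) auto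
    ultimately show ?thesis unfolding \<phi>'_def by (simp only: sum.neutral_const simp_thms)
  qed
  have prod_le: "\<bar>\<Prod>b\<in>B. bump (f b)\<bar> \<le> 1" for B :: "'a set" and f
    by (simp add: abs_prod prod_le_1 abs_bump_le)
  have \<phi>'_le: "norm (\<phi>' k z) \<le> J / \<delta>" for k z
  proof -
    have "norm ((\<Prod>j\<in>Basis - {b}. bump (y j z - real_of_int (k j))) *\<^sub>R \<psi>' k b z) \<le> 1 / \<delta>"
      if "b \<in> Basis" for b
    proof -
      have "norm (blinfun_inner_left (b /\<^sub>R \<delta>)) \<le> 1 / \<delta>"
        using norm_blinfun_inner_left_le[of "b /\<^sub>R \<delta>"] that \<delta> by (simp add: divide_inverse)
      then have "norm (\<psi>' k b z) \<le> 1 * (1 / \<delta>)"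
        unfolding \<psi>'_def norm_scaleR by (intro mult_mono) (auto simp: abs_bump'_le)
      then show ?thesis
        unfolding norm_scaleR using mult_mono[OF prod_le, of "norm (\<psi>' k b z)" "1 / \<delta>"] by simp
    qed
    then have "norm (\<phi>' k z) \<le> real (card (Basis :: 'a set)) * (1 / \<delta>)"
      unfolding \<phi>'_def by (rule sum_norm_bound)
    then show ?thesis by (simp add: J_def)
  qed
  have card_near: "real (card {k \<in> I. near z k}) \<le> M" for z
  proof -
    define B where "B b = {m. y b z - 3 \<le> real_of_int m \<and> real_of_int m \<le> y b z}" for b
    have "{k \<in> I. near z k} \<subseteq> PiE Basis B"
      unfolding I_def near_def B_def by (auto simp: PiE_iff extensional_def)
    moreover have "finite (PiE Basis B)"
      unfolding B_def by (intro finite_PiE finite_Basis card_int_window)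
    ultimately have "card {k \<in> I. near z k} \<le> (\<Prod>b\<in>Basis. card (B b))"
      by (metis card_mono card_PiE finite_Basis)
    also have "\<dots> \<le> (\<Prod>b\<in>(Basis::'a set). 4)"
      by (intro prod_mono) (auto simp: B_def card_int_window)
    finally have "card {k \<in> I. near z k} \<le> 4 ^ DIM('a)" by simp
    then show ?thesis unfolding M_def by (metis of_nat_le_iff of_nat_numeral of_nat_power)
  qed
  \<comment> \<open>The point \<open>z\<close> itself shows that the choice of \<open>c k\<close>
    succeeds. Both points then lie in one box of side \<open>3 * \<delta>\<close>, and the
    \<open>l1\<close> norm bounds their distance.\<close>
  have near_T: "\<bar>T k z - v z\<bar> \<le> \<eta> * (3 * J * \<delta>) \<and> norm (v' (c k) - v' z) \<le> \<eta>"
    if "z \<in> K" "near z k" for z k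
  proof -
    have c: "c k \<in> K" "near (c k) k"
      using someI[of "\<lambda>c. c \<in> K \<and> near c k" z] that unfolding c_def by auto
    have "\<bar>(z - c k) \<bullet> b\<bar> \<le> 3 * \<delta>" if "b \<in> Basis" for b
    proof -
      have "\<bar>y b z - y b (c k)\<bar> \<le> 3"
        using that \<open>near z k\<close> \<open>near (c k) k\<close> unfolding near_def abs_le_iff by fastforce
      moreover have "(z - c k) \<bullet> b = (y b z - y b (c k)) * \<delta>"
        using \<delta> by (simp add: y_eq inner_diff_left field_simps)
      ultimately show ?thesis
        using \<delta> by (simp add: abs_mult)
    qed
    then have "(\<Sum>b\<in>Basis. \<bar>(z - c k) \<bullet> b\<bar>) \<le> (\<Sum>b\<in>(Basis::'a set). 3 * \<delta>)"
      by (rule sum_mono)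
    then have n: "norm (z - c k) \<le> 3 * J * \<delta>"
      using norm_le_l1[of "z - c k"] by (simp add: J_def mult_ac)
    have "\<bar>v z - v (c k) - v' (c k) (z - c k)\<bar> \<le> \<eta> * norm (z - c k)" "norm (v' z - v' (c k)) \<le> \<eta>"
      using \<delta>0(2)[OF c(1) that(1)] n \<delta>(3) by auto
    moreover have "T k z - v z = - (v z - v (c k) - v' (c k) (z - c k))"
      by (simp add: T_def blinfun.diff_right)
    moreover have "\<eta> * norm (z - c k) \<le> \<eta> * (3 * J * \<delta>)"
      using n \<eta>(1) by (intro mult_left_mono) auto
    ultimately show ?thesis by (simp add: norm_minus_commute)
  qed

  have g_close: "\<bar>g z - v z\<bar> \<le> e / 2" if z: "z \<in> K" for z
  proof -
    have "g z - v z = (\<Sum>k\<in>I. \<phi> k z * (T k z - v z))"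
      using sum_\<phi>[of z] z R by (simp add: g_def right_diff_distrib sum_subtractf subset_iff
          flip: sum_distrib_right)
    also have "\<dots> = (\<Sum>k\<in>{k \<in> I. near z k}. \<phi> k z * (T k z - v z))"
      using far \<open>finite I\<close> by (intro sum.mono_neutral_right) auto
    finally have "\<bar>g z - v z\<bar> = norm \<dots>" by simp
    also have "\<dots> \<le> real (card {k \<in> I. near z k}) * (1 * (\<eta> * (3 * J * \<delta>)))"
    proof (rule sum_norm_bound)
      fix k assume "k \<in> {k \<in> I. near z k}"
      then show "norm (\<phi> k z * (T k z - v z)) \<le> 1 * (\<eta> * (3 * J * \<delta>))"
        unfolding norm_mult \<phi>_def using near_T[OF z] prod_le by (intro mult_mono) auto
    qed
    also have "\<dots> \<le> M * (1 * (\<eta> * (3 * J * \<delta>)))"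
      using \<eta> J \<delta> by (intro mult_right_mono card_near) auto
    also have "\<dots> \<le> M * (\<eta> * (1 + 3 * J + 3 * J\<^sup>2))"
    proof -
      have "3 * J * \<delta> \<le> 3 * J * 1" using J \<delta> by (intro mult_left_mono) auto
      also have "\<dots> \<le> 1 + 3 * J + 3 * J\<^sup>2" by simp
      finally show ?thesis using M \<eta> by (simp add: mult_left_mono)
    qed
    finally show ?thesis using \<eta> by simp
  qed
  have g'_close: "norm (g' z - v' z) \<le> e / 2" if z: "z \<in> K" for z
  proof -
    \<comment> \<open>Since the gradients \<open>\<phi>' k z\<close> sum to 0, \<open>v z\<close>
      may be subtracted from every \<open>T k z\<close>, so that only small Taylor errors multiply
      large gradients.\<close>
    have "(\<Sum>k\<in>I. \<phi> k z *\<^sub>R v' z) = v' z" "(\<Sum>k\<in>I. v z *\<^sub>R \<phi>' k z) = 0"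
      using sum_\<phi>[of z] sum_\<phi>'[of z] z R
      by (auto simp: subset_iff simp flip: scaleR_sum_left scaleR_sum_right)
    then have "g' z - v' z = (\<Sum>k\<in>I. \<phi> k z *\<^sub>R (v' (c k) - v' z) + (T k z - v z) *\<^sub>R \<phi>' k z)"
      by (simp add: g'_def scaleR_diff_right scaleR_diff_left sum_subtractf sum.distrib)
    also have "\<dots> = (\<Sum>k\<in>{k \<in> I. near z k}. \<phi> k z *\<^sub>R (v' (c k) - v' z) + (T k z - v z) *\<^sub>R \<phi>' k z)"
      using far \<open>finite I\<close> by (intro sum.mono_neutral_right) auto
    also have "norm \<dots> \<le> real (card {k \<in> I. near z k}) * (1 * \<eta> + (\<eta> * (3 * J * \<delta>)) * (J / \<delta>))"
    proof (rule sum_norm_bound)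
      fix k assume k: "k \<in> {k \<in> I. near z k}"
      have "norm (\<phi> k z *\<^sub>R (v' (c k) - v' z)) \<le> 1 * \<eta>"
        unfolding norm_scaleR \<phi>_def using near_T[OF z] k prod_le by (intro mult_mono) auto
      moreover have "norm ((T k z - v z) *\<^sub>R \<phi>' k z) \<le> (\<eta> * (3 * J * \<delta>)) * (J / \<delta>)"
        unfolding norm_scaleR using near_T[OF z] k \<eta> J \<delta> by (intro mult_mono \<phi>'_le) auto
      ultimately show "norm (\<phi> k z *\<^sub>R (v' (c k) - v' z) + (T k z - v z) *\<^sub>R \<phi>' k z)
          \<le> 1 * \<eta> + (\<eta> * (3 * J * \<delta>)) * (J / \<delta>)"
        by (rule norm_triangle_mono)
    qed
    also have "\<dots> \<le> M * (1 * \<eta> + (\<eta> * (3 * J * \<delta>)) * (J / \<delta>))"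
      using \<eta> J \<delta> by (intro mult_right_mono card_near) auto
    \<comment> \<open>The mesh size cancels: the Taylor error is proportional to
      \<open>\<delta>\<close>, the gradient bound to its inverse.\<close>
    also have "1 * \<eta> + (\<eta> * (3 * J * \<delta>)) * (J / \<delta>) = \<eta> * (1 + 3 * J\<^sup>2)"
      using \<delta> by (simp add: power2_eq_square algebra_simps)
    also have "M * (\<eta> * (1 + 3 * J\<^sup>2)) \<le> M * (\<eta> * (1 + 3 * J + 3 * J\<^sup>2))"
      using M \<eta> J by (intro mult_left_mono) auto
    finally show ?thesis using \<eta> by simp
  qed

  obtain P P' where P: "\<And>n. real_polynomial_function (P n)"
    "\<And>n z. (P n has_derivative blinfun_apply (P' n z)) (at z)"
    and "uniform_limit K P g sequentially" "uniform_limit K P' g' sequentially"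
    using g_limit unfolding C1_polynomial_limit_def by blast
  then have "\<forall>\<^sub>F n in sequentially. (\<forall>z\<in>K. dist (P n z) (g z) < e / 2) \<and> (\<forall>z\<in>K. dist (P' n z) (g' z) < e / 2)"
    using \<open>e > 0\<close> by (intro eventually_conj) (auto dest!: uniform_limitD[where e = "e / 2"])
  then obtain n where n: "\<And>z. z \<in> K \<Longrightarrow> dist (P n z) (g z) < e / 2" "\<And>z. z \<in> K \<Longrightarrow> dist (P' n z) (g' z) < e / 2"
    by (auto simp: eventually_sequentially)
  show thesis
  proof (rule that[OF P])
    show "\<bar>P n z - v z\<bar> \<le> e" if "z \<in> K" for z
      using n(1)[OF that] g_close[OF that] unfolding dist_real_def by linarith
    show "norm (P' n z - v' z) \<le> e" if "z \<in> K" for z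
      using n(2)[OF that] g'_close[OF that] norm_triangle_ineq[of "P' n z - g' z" "g' z - v' z"]
      by (simp add: dist_norm)
  qed
qed

section \<open>Differentiability of polynomials, Lie derivatives and bounds on the dynamics\<close>

text \<open>Supplies the continuity of the derivative that \<open>C1_near\<close> demands, which
  \<open>C1_Weierstrass\<close> does not state for its polynomial.\<close>

lemma real_polynomial_function_C1:
  assumes "real_polynomial_function P"
  shows "\<exists>P'. (\<forall>z. (P has_derivative blinfun_apply (P' z)) (at z)) \<and> continuous_on UNIV P'"
  using assms
proof (induction rule: real_polynomial_function.induct)
  case (linear f)
  then show ?case
    by (intro exI[of _ "\<lambda>_. Blinfun f"])
      (auto simp: bounded_linear_Blinfun_apply bounded_linear_imp_has_derivative)
next
  case (const c)
  show ?case
    by (intro exI[of _ "\<lambda>_. 0"]) (auto intro: has_derivative_eq_rhs[OF has_derivative_const])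
next
  case (add f g)
  then obtain f' g' where
    D: "\<And>z. (f has_derivative blinfun_apply (f' z)) (at z)" "\<And>z. (g has_derivative blinfun_apply (g' z)) (at z)"
    and "continuous_on UNIV f'" "continuous_on UNIV g'" by blast
  then show ?case
    by (intro exI[of _ "\<lambda>z. f' z + g' z"])
      (auto intro!: continuous_intros has_derivative_eq_rhs[OF has_derivative_add[OF D]] simp: plus_blinfun.rep_eq)
next
  case (mult f g)
  then obtain f' g' where
    D: "\<And>z. (f has_derivative blinfun_apply (f' z)) (at z)" "\<And>z. (g has_derivative blinfun_apply (g' z)) (at z)"
    and "continuous_on UNIV f'" "continuous_on UNIV g'" by blast
  moreover have "continuous_on UNIV f" "continuous_on UNIV g"
    using D by (meson has_derivative_continuous continuous_at_imp_continuous_on)+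
  ultimately show ?case
    by (intro exI[of _ "\<lambda>z. f z *\<^sub>R g' z + g z *\<^sub>R f' z"])
      (auto intro!: continuous_intros has_derivative_eq_rhs[OF has_derivative_mult[OF D]]
        simp: plus_blinfun.rep_eq scaleR_blinfun.rep_eq fun_eq_iff)
qed

text \<open>The Lie derivative is the derivative in the direction of time and velocity together, so
  operator norm bounds apply to it.\<close>

lemma lie_derivative_has_derivative:
  fixes f0 :: "real \<Rightarrow> real^'n \<Rightarrow> real^'n::finite" and f :: "'l::finite \<Rightarrow> real \<Rightarrow> real^'n \<Rightarrow> real^'n"
  assumes "(v has_derivative D) (at (t, x))"
  shows "lie_derivative f0 f v t x w = D (1, dynamics f0 f t x w)"
proof -
  interpret D: bounded_linear D using assms by (rule has_derivative_bounded_linear)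
  have "((\<lambda>s. v (s, x)) has_derivative (\<lambda>h. D (h, 0))) (at t)"
    by (rule has_derivative_compose[of "\<lambda>s. (s, x)" "\<lambda>h. (h, 0)" t UNIV v D])
      (auto intro!: derivative_eq_intros assms)
  moreover have "(\<lambda>h. D (h, 0)) = (*) (D (1, 0))"
  proof
    show "D (h, 0) = D (1, 0) * h" for h
      using D.scaleR[of h "(1, 0)"] by simp
  qed
  ultimately have t: "deriv (\<lambda>s. v (s, x)) t = D (1, 0)"
    by (intro DERIV_imp_deriv) (simp only: has_field_derivative_def)
  have "((\<lambda>y. v (t, y)) has_derivative (\<lambda>h. D (0, h))) (at x)"
    by (rule has_derivative_compose[of "\<lambda>y. (t, y)" "\<lambda>h. (0, h)" x UNIV v D])
      (auto intro!: derivative_eq_intros assms)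
  then have *: "frechet_derivative (\<lambda>y. v (t, y)) (at x) = (\<lambda>h. D (0, h))"
    by (rule frechet_derivative_at[symmetric])
  have grad: "grad_x v t x \<bullet> y = D (0, y)" for y
  proof -
    have lin: "linear (\<lambda>h. D (0, h))"
    proof (rule linearI)
      show "D (0, b1 + b2) = D (0, b1) + D (0, b2)" for b1 b2
        using D.add[of "(0, b1)" "(0, b2)"] by simp
      show "D (0, r *\<^sub>R b) = r *\<^sub>R D (0, b)" for r b
        using D.scaleR[of r "(0, b)"] by simp
    qed
    have "D (0, y) = D (0, \<Sum>i\<in>UNIV. (y $ i) *\<^sub>R axis i 1)"
      by (simp add: basis_expansion flip: scalar_mult_eq_scaleR)
    also have "\<dots> = (\<Sum>i\<in>UNIV. y $ i * D (0, axis i 1))"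
      by (simp add: linear_sum[OF lin] linear_cmul[OF lin])
    finally show ?thesis
      by (simp add: grad_x_def * inner_vec_def mult.commute)
  qed
  have "(1 :: real, dynamics f0 f t x w) = (1, 0) + (0, dynamics f0 f t x w)" by simp
  then have "D (1, dynamics f0 f t x w) = D (1, 0) + D (0, dynamics f0 f t x w)"
    by (metis D.add)
  then show ?thesis
    by (simp add: lie_derivative_def t dynamics_def inner_add_right inner_sum_right flip: grad)
qed

text \<open>Bounds the direction of differentiation uniformly, so that closeness of derivatives
  gives uniform closeness of Lie derivatives.\<close>

lemma bounded_dynamics:
  fixes f0 :: "real \<Rightarrow> real^'n \<Rightarrow> real^'n::finite" and f :: "'l::finite \<Rightarrow> real \<Rightarrow> real^'n \<Rightarrow> real^'n"
  assumes "compact X" and "bounded W"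
    and "continuous_on ({a..b} \<times> X) (\<lambda>(t, x). f0 t x)"
    and "\<And>l. continuous_on ({a..b} \<times> X) (\<lambda>(t, x). f l t x)"
  obtains M where "\<And>t x w. \<lbrakk>t \<in> {a..b}; x \<in> X; w \<in> W\<rbrakk> \<Longrightarrow> norm (dynamics f0 f t x w) \<le> M"
proof -
  have "compact ({a..b} \<times> X)" using assms by (intro compact_Times) auto
  then have *: "\<exists>B. \<forall>t\<in>{a..b}. \<forall>x\<in>X. norm (h t x) \<le> B"
    if "continuous_on ({a..b} \<times> X) (\<lambda>(t, x). h t x)" for h :: "real \<Rightarrow> real^'n \<Rightarrow> real^'n"
    using compact_imp_bounded[OF compact_continuous_image[OF that]] unfolding bounded_iff by auto
  obtain B0 where B0: "\<And>t x. t \<in> {a..b} \<Longrightarrow> x \<in> X \<Longrightarrow> norm (f0 t x) \<le> B0"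
    using *[OF assms(3)] by blast
  obtain B where B: "\<And>l t x. t \<in> {a..b} \<Longrightarrow> x \<in> X \<Longrightarrow> norm (f l t x) \<le> B l"
    using *[OF assms(4)] by metis
  obtain C where C: "\<And>w. w \<in> W \<Longrightarrow> norm w \<le> C"
    using \<open>bounded W\<close> by (auto simp: bounded_iff)
  show thesis
  proof
    fix t x w assume "t \<in> {a..b}" "x \<in> X" "w \<in> W"
    have "norm (w $ l *\<^sub>R f l t x) \<le> C * B l" for l
    proof -
      have "\<bar>w $ l\<bar> \<le> C"
        using component_le_norm_cart[of w l] C[OF \<open>w \<in> W\<close>] by linarith
      then show ?thesis
        using B[OF \<open>t \<in> {a..b}\<close> \<open>x \<in> X\<close>, of l] by (auto intro!: mult_mono)
    qed
    then show "norm (dynamics f0 f t x w) \<le> B0 + (\<Sum>l\<in>UNIV. C * B l)"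
      unfolding dynamics_def
      using B0[OF \<open>t \<in> {a..b}\<close> \<open>x \<in> X\<close>] by (intro norm_triangle_mono sum_norm_le) auto
  qed
qed

section \<open>Strictly feasible polynomials for the peak estimation program\<close>

theorem theorem3p1:
  fixes T \<epsilon> :: real
    and X X0 :: "(real^'n::finite) set"
    and W :: "(real^'l::finite) set"
    and f0 :: "real \<Rightarrow> real^'n \<Rightarrow> real^'n"
    and f :: "'l \<Rightarrow> real \<Rightarrow> real^'n \<Rightarrow> real^'n"
    and p :: "real^'n \<Rightarrow> real"
  assumes "T > 0"
    and "compact X" and "compact X0" and "X0 \<subseteq> X"
    and "\<exists>C. C-lipschitz_on ({0..T} \<times> X) (\<lambda>(t, x). f0 t x)"
    and "\<And>l. \<exists>C. C-lipschitz_on ({0..T} \<times> X) (\<lambda>(t, x). f l t x)"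
    and "compact W" and "interior W \<noteq> {}" and "semidefinite_representable W"
    and "non_return T X X0 W f0 f"
    and "lower_semicontinuous_on X p" and "bounded (p ` X)"
    and "\<epsilon> > 0"
  shows "\<exists>V :: real \<times> (real^'n) \<Rightarrow> real. real_polynomial_function V \<and>
           peak_feasible T X X0 W f0 f p V (peak_value T X X0 W f0 f p + 5 / 2 * \<epsilon>) \<and>
           (\<forall>t\<in>{0..T}. \<forall>x\<in>X. \<forall>w\<in>W. lie_derivative f0 f V t x w < 0)"
proof -
  let ?\<Gamma> = "{\<gamma>. \<exists>v. peak_feasible T X X0 W f0 f p v \<gamma>}"
  \<comment> \<open>A constant above \<open>p\<close> is feasible. Nonemptiness allows a feasible
    value below the infimum plus \<open>\<epsilon> / 2\<close> to be chosen.\<close>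
  have "?\<Gamma> \<noteq> {}"
  proof -
    obtain b where b: "\<And>x. x \<in> X \<Longrightarrow> p x \<le> b"
      using \<open>bounded (p ` X)\<close> by (auto simp: bounded_iff intro: order_trans[OF abs_ge_self])
    have const: "((\<lambda>_. b) has_derivative blinfun_apply 0) (at z)" for z :: "real \<times> (real^'n)"
      by (rule has_derivative_eq_rhs[OF has_derivative_const]) auto
    have "peak_feasible T X X0 W f0 f p (\<lambda>_. b) b"
      unfolding peak_feasible_def C1_near_def
      using b const
      by (auto simp: lie_derivative_has_derivative[OF const] intro!: exI[of _ UNIV] exI[of _ "\<lambda>_. 0"])
    then show ?thesis by blast
  qed
  then obtain \<gamma> v where v: "peak_feasible T X X0 W f0 f p v \<gamma>"
    and \<gamma>: "\<gamma> < peak_value T X X0 W f0 f p + \<epsilon> / 2"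
    using cInf_lessD[of ?\<Gamma> "peak_value T X X0 W f0 f p + \<epsilon> / 2"] \<open>\<epsilon> > 0\<close>
    by (auto simp: peak_value_def)
  let ?K = "{0..T} \<times> X"
  have "C1_near ?K v"
    using v by (simp add: peak_feasible_def)
  then obtain U v' where "open U \<and> ?K \<subseteq> U \<and>
      (\<forall>z\<in>U. (v has_derivative blinfun_apply (v' z)) (at z)) \<and> continuous_on U v'"
    unfolding C1_near_def by (elim exE)
  then have U: "open U" "?K \<subseteq> U" "continuous_on U v'"
    "\<And>z. z \<in> U \<Longrightarrow> (v has_derivative blinfun_apply (v' z)) (at z)"
    by auto
  have cont: "continuous_on ?K (\<lambda>(t, x). f0 t x)" "\<And>l. continuous_on ?K (\<lambda>(t, x). f l t x)"
    using assms(5,6) lipschitz_on_continuous_on by blast+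
  obtain M where M: "\<And>t x w. \<lbrakk>t \<in> {0..T}; x \<in> X; w \<in> W\<rbrakk> \<Longrightarrow> norm (dynamics f0 f t x w) \<le> M"
    by (rule bounded_dynamics[where ?f0.0 = f0 and f = f, OF \<open>compact X\<close> compact_imp_bounded[OF \<open>compact W\<close>] cont])
      (rule that)
  have M': "norm (1::real, dynamics f0 f t x w) \<le> 1 + \<bar>M\<bar>" if "t \<in> {0..T}" "x \<in> X" "w \<in> W" for t x w
    using M[OF that] norm_Pair_le[of "1::real" "dynamics f0 f t x w"] by simp
  define a where "a = \<epsilon> / T"
  have a: "a > 0" using \<open>\<epsilon> > 0\<close> \<open>T > 0\<close> by (simp add: a_def)
  \<comment> \<open>The added term falls from \<open>3 / 2 * \<epsilon>\<close> at time 0 to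
    \<open>\<epsilon> / 2\<close> at time \<open>T\<close>, and its slope lowers the Lie derivative
    by \<open>a\<close>.\<close>
  define u where "u z = v z + (3 / 2 * \<epsilon> - a * fst z)" for z
  define L :: "(real \<times> (real^'n)) \<Rightarrow>\<^sub>L real" where "L = a *\<^sub>R Blinfun fst"
  have L: "L (s, y) = a * s" for s y
    by (simp add: L_def scaleR_blinfun.rep_eq bounded_linear_Blinfun_apply bounded_linear_fst)
  have u: "(u has_derivative blinfun_apply (v' z - L)) (at z)" if "z \<in> U" for z
    unfolding u_def using U(4)[OF that]
    by (auto intro!: derivative_eq_intros simp: minus_blinfun.rep_eq L fun_eq_iff)
  have cont_u: "continuous_on U (\<lambda>z. v' z - L)"
    using U(3) by (intro continuous_intros)
  \<comment> \<open>The first bound is for values. The second keeps the error of the Lie derivative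
    at most \<open>a / 2\<close>, which preserves strictness.\<close>
  define e where "e = min (\<epsilon> / 2) (a / (2 * (1 + \<bar>M\<bar>)))"
  have e: "e > 0" "e \<le> \<epsilon> / 2" "e * (1 + \<bar>M\<bar>) < a"
  proof -
    show "e > 0" using a \<open>\<epsilon> > 0\<close> by (simp add: e_def)
    show "e \<le> \<epsilon> / 2" unfolding e_def by (rule min.cobounded1)
    have "e * (1 + \<bar>M\<bar>) \<le> a / (2 * (1 + \<bar>M\<bar>)) * (1 + \<bar>M\<bar>)"
      unfolding e_def by (intro mult_right_mono) auto
    also have "\<dots> = a / 2" by (simp add: field_simps)
    also have "\<dots> < a" using a by simp
    finally show "e * (1 + \<bar>M\<bar>) < a" .
  qed
  have K: "compact ?K" using \<open>compact X\<close> by (intro compact_Times) auto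
  obtain V V' where V: "real_polynomial_function V"
    "\<And>z. (V has_derivative blinfun_apply (V' z)) (at z)"
    "\<And>z. z \<in> ?K \<Longrightarrow> \<bar>V z - u z\<bar> \<le> e" "\<And>z. z \<in> ?K \<Longrightarrow> norm (V' z - (v' z - L)) \<le> e"
    by (rule C1_Weierstrass[OF K U(1,2) u cont_u e(1)]) (assumption, rule that)
  have lie: "lie_derivative f0 f V t x w < 0" if "t \<in> {0..T}" "x \<in> X" "w \<in> W" for t x w
  proof -
    let ?h = "(1, dynamics f0 f t x w)"
    have tx: "(t, x) \<in> ?K" using that by simp
    have "blinfun_apply (v' (t, x)) ?h \<le> 0"
    proof -
      have "lie_derivative f0 f v t x w \<le> 0"
        using v that unfolding peak_feasible_def by blast
      then show ?thesis
        using lie_derivative_has_derivative[OF U(4)[OF subsetD[OF U(2) tx]], of f0 f w] by simp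
    qed
    moreover have "\<bar>(V' (t, x) - (v' (t, x) - L)) ?h\<bar> \<le> e * (1 + \<bar>M\<bar>)"
      using norm_blinfun[of "V' (t, x) - (v' (t, x) - L)" ?h]
        mult_mono[OF V(4)[OF tx] M'[OF that]] e by simp
    ultimately show ?thesis
      using e by (simp add: lie_derivative_has_derivative[OF V(2)] minus_blinfun.rep_eq L)
  qed
  have "C1_near ?K V"
    using real_polynomial_function_C1[OF V(1)] unfolding C1_near_def
    by (intro exI[of _ UNIV]) auto
  \<comment> \<open>The budget adds up as \<open>\<epsilon> / 2\<close> for near-optimality of
    \<open>\<gamma>\<close>, \<open>3 / 2 * \<epsilon>\<close> for the shift and
    \<open>\<epsilon> / 2\<close> for the approximation.\<close>
  moreover have "V (0, x) \<le> peak_value T X X0 W f0 f p + 5 / 2 * \<epsilon>" if "x \<in> X0" for x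
  proof -
    have "(0, x) \<in> ?K" using that \<open>X0 \<subseteq> X\<close> \<open>T > 0\<close> by auto
    moreover have "v (0, x) \<le> \<gamma>" using v that by (simp add: peak_feasible_def)
    ultimately show ?thesis using V(3)[of "(0, x)"] e \<gamma> by (auto simp: u_def)
  qed
  \<comment> \<open>The shift \<open>3 / 2 * \<epsilon>\<close> pays for the decrease in time, at
    most \<open>\<epsilon>\<close>, and for the approximation error, at most
    \<open>\<epsilon> / 2\<close>.\<close>
  moreover have "p x \<le> V (t, x)" if "t \<in> {0..T}" "x \<in> X" for t x
  proof -
    have "a * t \<le> a * T" using a that by (intro mult_left_mono) auto
    then have "a * t \<le> \<epsilon>" using \<open>T > 0\<close> by (simp add: a_def)
    moreover have "p x \<le> v (t, x)" using v that by (simp add: peak_feasible_def)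
    ultimately show ?thesis using V(3)[of "(t, x)"] e that by (auto simp: u_def)
  qed
  ultimately have "peak_feasible T X X0 W f0 f p V (peak_value T X X0 W f0 f p + 5 / 2 * \<epsilon>)"
    unfolding peak_feasible_def using lie less_imp_le by blast
  then show ?thesis using V(1) lie by blast
qed

end
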